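(* Let $A,T\in M_n(\mathbb{C})$ and $\alpha,\beta\in\mathbb{R}$ satisfy $$\Delta_A^2(T)+\alpha\,\Delta_A(T)+\beta\,T=0,$$ and let $z_1,z_2$ be the roots of $P(z)=z^2+\alpha z+\beta$. (i) Double zero root ($\alpha=\beta=0$): $\Delta_A(T)$ is nilpotent, while $T$ need not be, as any non-nilpotent $T$ commuting with $A$ shows. (ii) Roots with non-zero real parts of the same sign (distinct real roots with $z_1z_2>0$, a repeated root $z_0\neq 0$, or complex conjugate roots $\gamma\pm i\omega$ with $\gamma\neq 0$): both $T$ and $\Delta_A(T)$ are nilpotent. (iii) Purely imaginary roots ($z_{1,2}=\pm i\omega$ with $\omega\neq 0$): neither matrix ($T$ nor $\Delta_A(T)$) need be nilpotent. (iv) One zero root and one non-zero real root ($\beta=0$, $\alpha\neq 0$): $\Delta_A(T)$ is nilpotent, while $T$ need not be. (v) Opposite-sign real roots ($\beta<0$): if $z_1/z_2\notin\mathbb{Q}$, or if $z_1/z_2=-p/q$ in lowest terms with $p+q>n$, then both $T$ and $\Delta_A(T)$ are nilpotent. Otherwise there are $A,T\in M_n(\mathbb{C})$ satisfying the relation such that neither $T$ nor $\Delta_A(T)$ is nilpotent.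
   Context: $M_n(\mathbb{C})$ is the algebra of $n\times n$ complex matrices. For $A\in M_n(\mathbb{C})$ the inner derivation induced by $A$ is $\Delta_A(T)=AT-TA$ for $T\in M_n(\mathbb{C})$, with iterates $\Delta_A^0(T)=T$ and $\Delta_A^k(T)=\Delta_A(\Delta_A^{k-1}(T))$ for $k\ge 1$. A matrix $M$ is nilpotent if $M^k=0$ for some $k\ge 1$. The numbers $\gamma,\omega$ are real, with $\omega\neq 0$. Writing $z_1/z_2=-p/q$ in lowest terms means that $p,q$ are positive integers with $\gcd(p,q)=1$.
   Formalization: In (iii) the claim that neither T nor Δ_A(T) need be nilpotent is stated for n ≥ 2 only, since for n = 1 one has Δ_A(T) = 0 and the relation with β = ω² ≠ 0 forces T = 0. *)

theory Defs
  imports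
    Complex_Main
    "HOL-Computational_Algebra.Polynomial"
    "Jordan_Normal_Form.Matrix"
begin

definition inner_derivation :: "complex mat \<Rightarrow> complex mat \<Rightarrow> complex mat" where
  "inner_derivation A T = A * T - T * A"

definition nilpotent_mat :: "complex mat \<Rightarrow> bool" where
  "nilpotent_mat M \<longleftrightarrow> (\<exists>k\<ge>1. M ^\<^sub>m k = 0\<^sub>m (dim_row M) (dim_row M))"

definition quadratic_relation ::
    "nat \<Rightarrow> real \<Rightarrow> real \<Rightarrow> complex mat \<Rightarrow> complex mat \<Rightarrow> bool" where
  "quadratic_relation n \<alpha> \<beta> A T \<longleftrightarrow>
     A \<in> carrier_mat n n \<and> T \<in> carrier_mat n n \<and>
     (inner_derivation A ^^ 2) T + complex_of_real \<alpha> \<cdot>\<^sub>m inner_derivation A T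
       + complex_of_real \<beta> \<cdot>\<^sub>m T = 0\<^sub>m n n"

(* The two roots listed with multiplicity, so that z1 = z2 exactly for a repeated root. *)
definition roots_of_quadratic :: "real \<Rightarrow> real \<Rightarrow> complex \<Rightarrow> complex \<Rightarrow> bool" where
  "roots_of_quadratic \<alpha> \<beta> z1 z2 \<longleftrightarrow>
     [:complex_of_real \<beta>, complex_of_real \<alpha>, 1:] = [:- z1, 1:] * [:- z2, 1:]"

definition neg_ratio_lowest_terms :: "complex \<Rightarrow> complex \<Rightarrow> nat \<Rightarrow> nat \<Rightarrow> bool" where
  "neg_ratio_lowest_terms z1 z2 p q \<longleftrightarrow>
     p > 0 \<and> q > 0 \<and> coprime p q \<and> z1 / z2 = - (of_nat p / of_nat q)"

end

theory Submission
  imports Defs "Jordan_Normal_Form.Schur_Decomposition"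
begin

text \<open>A complex \<open>n \<times> n\<close> matrix \<open>S\<close> is nilpotent once the traces of
\<open>S, S\<^sup>2, \<dots>, S\<^sup>n\<close> vanish, and traces interact well with the derivation
\<open>\<Delta> = \<Delta>\<^sub>A\<close>: every commutator has trace zero, so an eigenvector of \<open>\<Delta>\<close> for a non-zero
eigenvalue \<open>c\<close> has trace zero, because \<open>c\<close> times its trace is the trace of a
commutator. The same holds for generalized eigenvectors. Since \<open>\<Delta>\<close> obeys the Leibniz rule,
eigenvalues add under multiplication. The relation says that \<open>(\<Delta> - z\<^sub>1)(\<Delta> - z\<^sub>2)\<close> kills
\<open>T\<close>, hence \<open>T\<close> and \<open>\<Delta>(T)\<close> both lie in the sum of the generalized eigenspaces of \<open>\<Delta>\<close> for
\<open>z\<^sub>1\<close> and \<open>z\<^sub>2\<close>, and their \<open>k\<close>-th powers lie in the sum of those for the numbers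
\<open>i z\<^sub>1 + j z\<^sub>2\<close> with \<open>i + j = k\<close>. If none of these numbers vanishes for
\<open>1 \<le> i + j \<le> n\<close>, both matrices are nilpotent (\<open>quadratic_relation_nilpotent\<close>). This covers
the roots whose real parts have the same sign, simple or repeated, and the real roots of opposite
sign: there a resonance \<open>i z\<^sub>1 + j z\<^sub>2 = 0\<close> forces \<open>z\<^sub>1 / z\<^sub>2 = - j / i\<close>, which in lowest terms
\<open>- p / q\<close> needs \<open>p + q \<le> i + j \<le> n\<close>.

If one root is zero, only \<open>\<Delta>(T)\<close> is under control
(\<open>quadratic_relation_zero_root_nilpotent\<close>). When the other root \<open>z\<close> is
non-zero, \<open>\<Delta>(T)\<close> is zero or an eigenvector for \<open>z\<close>, and the above applies; when both are zero,
\<open>\<Delta>(T)\<close> commutes with \<open>A\<close>, so its powers \<open>\<Delta>(T)\<^sup>k = \<Delta>(\<Delta>(T)\<^sup>k\<^sup>-\<^sup>1 T)\<close> are themselves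
commutators. The identity matrix shows that \<open>T\<close> need not be nilpotent.

Conversely, a resonance \<open>q z\<^sub>1 + p z\<^sub>2 = 0\<close> with \<open>p + q \<le> n\<close> lets one walk around a cycle of
length \<open>p + q\<close>, taking \<open>q\<close> steps \<open>z\<^sub>1\<close> and \<open>p\<close> steps \<open>z\<^sub>2\<close>. With the positions on that walk as the
diagonal of \<open>A\<close> and the cyclic shift as \<open>T\<close>, both \<open>T\<close> and \<open>\<Delta>(T)\<close> are cyclic shifts with
non-zero weights, which are not nilpotent (\<open>resonant_roots_not_nilpotent\<close>). Purely imaginary
conjugate roots are the resonance with \<open>p = q = 1\<close>.\<close>

section \<open>Nilpotency from vanishing traces\<close>

definition mat_trace :: "complex mat \<Rightarrow> complex" where
  "mat_trace M = (\<Sum>i<dim_row M. M $$ (i,i))"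

lemma mat_trace_mult:
  assumes "X \<in> carrier_mat n m" "Y \<in> carrier_mat m n"
  shows "mat_trace (X * Y) = (\<Sum>i<n. \<Sum>j<m. X $$ (i,j) * Y $$ (j,i))"
  using assms by (auto simp: mat_trace_def scalar_prod_def atLeast0LessThan intro!: sum.cong)

lemma mat_trace_comm:
  assumes "X \<in> carrier_mat n m" "Y \<in> carrier_mat m n"
  shows "mat_trace (X * Y) = mat_trace (Y * X)"
  unfolding mat_trace_mult[OF assms] mat_trace_mult[OF assms(2,1)]
  by (subst sum.swap) (simp add: mult.commute)

lemma mat_trace_similar:
  assumes "A \<in> carrier_mat n n" "similar_mat_wit A B P Q"
  shows "mat_trace A = mat_trace B"
proof -
  note w = similar_mat_witD2[OF assms]
  have "mat_trace A = mat_trace (P * (B * Q))"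
    using w by (simp add: assoc_mult_mat[of P n n B n Q n])
  also have "\<dots> = mat_trace (B * Q * P)"
    using w by (intro mat_trace_comm) auto
  also have "B * Q * P = B"
    using w by (simp add: assoc_mult_mat[of B n n Q n P n])
  finally show ?thesis .
qed

text \<open>Given a non-zero value \<open>e i\<^sub>0\<close>, take the polynomial that vanishes at \<open>0\<close> and at every other value of
\<open>e\<close>, but not at \<open>e i\<^sub>0\<close>. It has no constant term and degree at most \<open>card I\<close>, so summing it over
all \<open>e i\<close> gives a combination of the vanishing power sums; yet the sum equals the value at \<open>e i\<^sub>0\<close>
times the number of indices that share it.\<close>

lemma power_sums_zero_imp_zero:
  fixes e :: "'a \<Rightarrow> complex"
  assumes fin: "finite I"
    and ps: "\<And>k. 1 \<le> k \<Longrightarrow> k \<le> card I \<Longrightarrow> (\<Sum>i\<in>I. e i ^ k) = 0"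
    and i0: "i0 \<in> I"
  shows "e i0 = 0"
proof (rule ccontr)
  assume nz: "e i0 \<noteq> 0"
  define N where "N = e ` I - {0, e i0}"
  define p where "p = [:0,1:] * (\<Prod>\<mu>\<in>N. [:-\<mu>,1:])"
  have finN: "finite N" using fin by (simp add: N_def)
  have pv: "poly p x = x * (\<Prod>\<mu>\<in>N. x - \<mu>)" for x
    by (simp add: p_def poly_prod)
  have "card N < card (e ` I)"
    using fin i0 by (intro psubset_card_mono) (auto simp: N_def)
  also have "\<dots> \<le> card I" using fin by (rule card_image_le)
  finally have cN: "card N < card I" .
  have "degree p \<le> degree [:0,1::complex:] + degree (\<Prod>\<mu>\<in>N. [:-\<mu>,1:])"
    unfolding p_def by (rule degree_mult_le)
  also have "\<dots> \<le> 1 + (\<Sum>\<mu>\<in>N. degree [:-\<mu>,1:])"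
    using degree_prod_sum_le[OF finN, of "\<lambda>\<mu>. [:-\<mu>,1:]"] by (simp add: o_def)
  also have "\<dots> = 1 + card N" by simp
  finally have deg: "degree p \<le> card I" using cN by linarith
  have "(\<Sum>i\<in>I. poly p (e i)) = (\<Sum>k\<le>degree p. coeff p k * (\<Sum>i\<in>I. e i ^ k))"
    unfolding poly_altdef by (subst sum.swap) (simp add: sum_distrib_left)
  also have "\<dots> = 0"
  proof (rule sum.neutral, rule ballI)
    fix k assume k: "k \<in> {..degree p}"
    show "coeff p k * (\<Sum>i\<in>I. e i ^ k) = 0"
    proof (cases "k = 0")
      case True
      have "coeff p 0 = poly p 0" by (simp add: poly_0_coeff_0)
      then show ?thesis using True by (simp add: pv)
    next
      case False
      then show ?thesis using ps[of k] k deg by simp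
    qed
  qed
  finally have zero: "(\<Sum>i\<in>I. poly p (e i)) = 0" .
  have "(\<Sum>i\<in>I. poly p (e i)) = (\<Sum>i\<in>{i\<in>I. e i = e i0}. poly p (e i))"
    using fin finN by (intro sum.mono_neutral_right) (auto simp: pv N_def)
  also have "\<dots> = of_nat (card {i\<in>I. e i = e i0}) * poly p (e i0)" by simp
  finally have "of_nat (card {i\<in>I. e i = e i0}) * poly p (e i0) = 0" using zero by simp
  moreover have "card {i\<in>I. e i = e i0} \<noteq> 0" using fin i0 by (auto simp: card_eq_0_iff)
  moreover have "poly p (e i0) \<noteq> 0" using nz finN by (auto simp: pv N_def)
  ultimately show False by simp
qed

lemma pow_mat_Suc_index:
  fixes A :: "'a :: semiring_1 mat"
  assumes A: "A \<in> carrier_mat n n" and ij: "i < n" "j < n"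
  shows "(A ^\<^sub>m Suc k) $$ (i,j) = (\<Sum>l<n. (A ^\<^sub>m k) $$ (i,l) * A $$ (l,j))"
proof -
  have "A ^\<^sub>m k \<in> carrier_mat n n" using A by simp
  then show ?thesis using A ij by (auto simp: scalar_prod_def atLeast0LessThan)
qed

lemma upper_triangular_pow:
  assumes B: "B \<in> carrier_mat n n" and ut: "upper_triangular B"
  shows "upper_triangular (B ^\<^sub>m k) \<and> (\<forall>i<n. (B ^\<^sub>m k) $$ (i,i) = B $$ (i,i) ^ k)"
proof (induction k)
  case 0
  then show ?case using B by auto
next
  case (Suc k)
  have C: "B ^\<^sub>m k \<in> carrier_mat n n" using B by simp
  have ent: "(B ^\<^sub>m Suc k) $$ (i,j) = (\<Sum>l<n. (B ^\<^sub>m k) $$ (i,l) * B $$ (l,j))"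
    if "i < n" "j < n" for i j
    by (rule pow_mat_Suc_index[OF B that])
  have z1: "(B ^\<^sub>m k) $$ (i,l) = 0" if "l < i" "i < n" for i l
    using upper_triangularD[of "B ^\<^sub>m k" l i] Suc.IH that C by auto
  have z2: "B $$ (i,l) = 0" if "l < i" "i < n" for i l
    using upper_triangularD[OF ut that(1)] that B by auto
  have "(B ^\<^sub>m Suc k) $$ (i,j) = 0" if "j < i" "i < n" for i j
  proof -
    have "(B ^\<^sub>m k) $$ (i,l) * B $$ (l,j) = 0" if l: "l < n" for l
    proof (cases "l < i")
      case True
      then show ?thesis using z1 \<open>i < n\<close> by simp
    next
      case False
      then show ?thesis using z2[of j l] l \<open>j < i\<close> by simp
    qed
    then show ?thesis using that by (subst ent) auto
  qed
  moreover have "(B ^\<^sub>m Suc k) $$ (i,i) = B $$ (i,i) ^ Suc k" if i: "i < n" for i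
  proof -
    have "(\<Sum>l<n. (B ^\<^sub>m k) $$ (i,l) * B $$ (l,i)) = (\<Sum>l\<in>{i}. (B ^\<^sub>m k) $$ (i,l) * B $$ (l,i))"
      proof (rule sum.mono_neutral_right)
      show "\<forall>l\<in>{..<n} - {i}. (B ^\<^sub>m k) $$ (i,l) * B $$ (l,i) = 0"
        using i z1 z2 by (metis DiffE lessThan_iff linorder_neqE_nat mult_zero_left mult_zero_right singletonI)
    qed (use i in auto)
    then show ?thesis using i Suc.IH by (subst ent) (auto simp: power_commutes)
  qed
  ultimately show ?case using B by auto
qed

text \<open>Each further factor moves the support of the power one diagonal up, so the power with exponent
\<open>n\<close> is zero.\<close>

lemma strictly_upper_triangular_pow:
  fixes B :: "'a :: semiring_1 mat"
  assumes B: "B \<in> carrier_mat n n" and su: "\<And>i j. i < n \<Longrightarrow> j \<le> i \<Longrightarrow> B $$ (i,j) = 0"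
  shows "i < n \<Longrightarrow> j < n \<Longrightarrow> j < i + k \<Longrightarrow> (B ^\<^sub>m k) $$ (i,j) = 0"
proof (induction k arbitrary: i j)
  case 0
  then show ?case using B by auto
next
  case (Suc k)
  have "(B ^\<^sub>m Suc k) $$ (i,j) = (\<Sum>l<n. (B ^\<^sub>m k) $$ (i,l) * B $$ (l,j))"
    by (rule pow_mat_Suc_index[OF B Suc.prems(1,2)])
  also have "\<dots> = 0"
  proof (rule sum.neutral, rule ballI)
    fix l assume l: "l \<in> {..<n}"
    show "(B ^\<^sub>m k) $$ (i,l) * B $$ (l,j) = 0"
    proof (cases "l < i + k")
      case True
      then show ?thesis using Suc.IH[of i l] Suc.prems l by simp
    next
      case False
      then show ?thesis using su[of l j] Suc.prems l by simp
    qed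
  qed
  finally show ?case .
qed

text \<open>By Schur triangularization the traces of the powers are the power sums of the eigenvalues, so all
eigenvalues vanish and the triangular form is strict.\<close>

lemma traces_zero_imp_nilpotent:
  assumes S: "S \<in> carrier_mat n n"
    and tr: "\<And>k. 1 \<le> k \<Longrightarrow> k \<le> n \<Longrightarrow> mat_trace (S ^\<^sub>m k) = 0"
  shows "nilpotent_mat S"
proof -
  obtain es where "char_poly S = (\<Prod>a\<leftarrow>es. [:- a, 1:])"
    using char_poly_factorized[OF S] by blast
  then obtain B where B: "B \<in> carrier_mat n n" and ut: "upper_triangular B" and "similar_mat S B"
    using schur_decomposition_exists[OF S] by blast
  then obtain P Q where w: "similar_mat_wit S B P Q" unfolding similar_mat_def by blast
  have pw: "similar_mat_wit (S ^\<^sub>m k) (B ^\<^sub>m k) P Q" for k by (rule similar_mat_wit_pow[OF w])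
  have "(\<Sum>i<n. B $$ (i,i) ^ k) = 0" if "1 \<le> k" "k \<le> n" for k
  proof -
    have "(\<Sum>i<n. B $$ (i,i) ^ k) = mat_trace (B ^\<^sub>m k)"
      using upper_triangular_pow[OF B ut, of k] B by (simp add: mat_trace_def)
    also have "\<dots> = mat_trace (S ^\<^sub>m k)"
      using mat_trace_similar[OF pow_carrier_mat[OF S] pw] by simp
    finally show ?thesis using tr[OF that] by simp
  qed
  then have "B $$ (i,i) = 0" if "i < n" for i
    using that by (intro power_sums_zero_imp_zero[of "{..<n}" "\<lambda>i. B $$ (i,i)"]) auto
  then have su: "B $$ (i,j) = 0" if "i < n" "j \<le> i" for i j
    using that upper_triangularD[OF ut, of j i] B by (cases "j = i") auto
  have "B ^\<^sub>m Suc n = 0\<^sub>m n n"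
  proof (rule eq_matI)
    fix i j assume "i < dim_row (0\<^sub>m n n :: complex mat)" "j < dim_col (0\<^sub>m n n :: complex mat)"
    then have "i < n" "j < n" by auto
    then show "(B ^\<^sub>m Suc n) $$ (i,j) = 0\<^sub>m n n $$ (i,j)"
      using strictly_upper_triangular_pow[OF B su, of i j "Suc n"] by simp
  qed (use B in auto)
  then have "S ^\<^sub>m Suc n = 0\<^sub>m n n"
    using similar_mat_wit_pow_id[OF w, of "Suc n"] similar_mat_witD2[OF S w] by simp
  then show ?thesis using S unfolding nilpotent_mat_def
    by (intro exI[of _ "Suc n"]) simp
qed

section \<open>The inner derivation and its spectral subspaces\<close>

lemma inner_derivation_dim [simp]:
  "dim_row (inner_derivation A X) = dim_row X" "dim_col (inner_derivation A X) = dim_col A"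
  by (simp_all add: inner_derivation_def)

lemma inner_derivation_carrier [simp]:
  "A \<in> carrier_mat n n \<Longrightarrow> X \<in> carrier_mat n n \<Longrightarrow> inner_derivation A X \<in> carrier_mat n n"
  by (rule carrier_matI) auto

lemma inner_derivation_add:
  assumes "A \<in> carrier_mat n n" "X \<in> carrier_mat n n" "Y \<in> carrier_mat n n"
  shows "inner_derivation A (X + Y) = inner_derivation A X + inner_derivation A Y"
  using assms unfolding inner_derivation_def
  by (simp add: mult_add_distrib_mat[of A n n X n Y] add_mult_distrib_mat[of X n n Y A n])
     (auto intro!: eq_matI)

lemma inner_derivation_smult:
  assumes "A \<in> carrier_mat n n" "X \<in> carrier_mat n n"
  shows "inner_derivation A (c \<cdot>\<^sub>m X) = c \<cdot>\<^sub>m inner_derivation A X"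
  using assms unfolding inner_derivation_def
  by (simp add: mult_smult_distrib[of A n n X n] mult_smult_assoc_mat[of X n n A n])
     (auto intro!: eq_matI simp: algebra_simps)

lemma inner_derivation_mult:
  assumes "A \<in> carrier_mat n n" "X \<in> carrier_mat n n" "Y \<in> carrier_mat n n"
  shows "inner_derivation A (X * Y) = inner_derivation A X * Y + X * inner_derivation A Y"
proof -
  have "inner_derivation A X * Y + X * inner_derivation A Y
      = (A * X * Y - X * A * Y) + (X * (A * Y) - X * (Y * A))"
    using assms unfolding inner_derivation_def
    by (simp add: minus_mult_distrib_mat[of "A * X" n n "X * A" Y n]
        mult_minus_distrib_mat[of X n n "A * Y" n "Y * A"])
  also have "X * (A * Y) = X * A * Y" using assms by simp
  also have "X * (Y * A) = X * Y * A" using assms by simp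
  also have "A * X * Y = A * (X * Y)" using assms by simp
  finally show ?thesis using assms unfolding inner_derivation_def
    by (auto intro!: eq_matI)
qed

lemma mat_trace_inner_derivation:
  assumes "A \<in> carrier_mat n n" "X \<in> carrier_mat n n"
  shows "mat_trace (inner_derivation A X) = 0"
proof -
  have "mat_trace (inner_derivation A X) = mat_trace (A * X) - mat_trace (X * A)"
    using assms unfolding inner_derivation_def mat_trace_def by (simp add: sum_subtractf)
  then show ?thesis using mat_trace_comm[OF assms] by simp
qed

text \<open>This is \<open>(\<Delta>\<^sub>A - c)(X)\<close>. The scalar is written as an addition, so that the distributive laws for
sums of matrices apply to it directly.\<close>

definition shifted_derivation :: "complex mat \<Rightarrow> complex \<Rightarrow> complex mat \<Rightarrow> complex mat" where
  "shifted_derivation A c X = inner_derivation A X + (- c) \<cdot>\<^sub>m X"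

lemma shifted_derivation_carrier [simp]:
  "A \<in> carrier_mat n n \<Longrightarrow> X \<in> carrier_mat n n \<Longrightarrow> shifted_derivation A c X \<in> carrier_mat n n"
  by (simp add: shifted_derivation_def)

lemma shifted_derivation_add:
  assumes "A \<in> carrier_mat n n" "X \<in> carrier_mat n n" "Y \<in> carrier_mat n n"
  shows "shifted_derivation A c (X + Y) = shifted_derivation A c X + shifted_derivation A c Y"
proof -
  have D: "inner_derivation A X \<in> carrier_mat n n" "inner_derivation A Y \<in> carrier_mat n n"
    using assms by simp_all
  show ?thesis unfolding shifted_derivation_def inner_derivation_add[OF assms]
    using assms D by (auto intro!: eq_matI simp: algebra_simps)
qed

lemma shifted_derivation_zero [simp]:
  assumes "A \<in> carrier_mat n n"
  shows "shifted_derivation A c (0\<^sub>m n n) = 0\<^sub>m n n"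
  using assms by (auto intro!: eq_matI simp: shifted_derivation_def inner_derivation_def)

lemma shifted_derivation_shifted_derivation:
  assumes "A \<in> carrier_mat n n" "X \<in> carrier_mat n n"
  shows "shifted_derivation A c (shifted_derivation A d X) =
    inner_derivation A (inner_derivation A X) + (- (c + d)) \<cdot>\<^sub>m inner_derivation A X + (c * d) \<cdot>\<^sub>m X"
proof -
  have D: "inner_derivation A X \<in> carrier_mat n n"
    "inner_derivation A (inner_derivation A X) \<in> carrier_mat n n"
    using assms by simp_all
  have "inner_derivation A (inner_derivation A X + (- d) \<cdot>\<^sub>m X) =
      inner_derivation A (inner_derivation A X) + (- d) \<cdot>\<^sub>m inner_derivation A X"
    using assms D by (simp add: inner_derivation_add[of A n] inner_derivation_smult[of A n])
  then show ?thesis unfolding shifted_derivation_def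
    using assms D by (auto intro!: eq_matI simp: algebra_simps)
qed

lemma shifted_derivation_commute:
  assumes "A \<in> carrier_mat n n" "X \<in> carrier_mat n n"
  shows "shifted_derivation A c (shifted_derivation A d X)
    = shifted_derivation A d (shifted_derivation A c X)"
  unfolding shifted_derivation_shifted_derivation[OF assms] by (simp add: add.commute mult.commute)

text \<open>The Leibniz rule with the shifts split between the two factors; it is the reason why eigenvalues of
\<open>\<Delta>\<^sub>A\<close> add under multiplication.\<close>

lemma shifted_derivation_mult:
  assumes "A \<in> carrier_mat n n" "X \<in> carrier_mat n n" "Y \<in> carrier_mat n n"
  shows "shifted_derivation A (c + d) (X * Y)
    = shifted_derivation A c X * Y + X * shifted_derivation A d Y"
proof -
  define DX DY where "DX = inner_derivation A X" and "DY = inner_derivation A Y"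
  have D: "DX \<in> carrier_mat n n" "DY \<in> carrier_mat n n"
    using assms by (simp_all add: DX_def DY_def)
  have 1: "(DX + (- c) \<cdot>\<^sub>m X) * Y = DX * Y + (- c) \<cdot>\<^sub>m (X * Y)"
    using assms D by (simp add: add_mult_distrib_mat[of _ n n] mult_smult_assoc_mat[of X n n Y n])
  have 2: "X * (DY + (- d) \<cdot>\<^sub>m Y) = X * DY + (- d) \<cdot>\<^sub>m (X * Y)"
    using assms D by (simp add: mult_add_distrib_mat[of _ n n _ n] mult_smult_distrib[of X n n Y n])
  have M: "DX * Y \<in> carrier_mat n n" "X * DY \<in> carrier_mat n n" "X * Y \<in> carrier_mat n n"
    using assms D by auto
  show ?thesis
    unfolding shifted_derivation_def inner_derivation_mult[OF assms]
      DX_def[symmetric] DY_def[symmetric] 1 2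
    using M by (auto intro!: eq_matI simp: algebra_simps)
qed

text \<open>The sum of the generalized eigenspaces of \<open>\<Delta>\<^sub>A\<close> for the eigenvalues in \<open>C\<close>: a matrix belongs to it
if finitely many operators \<open>\<Delta>\<^sub>A - c\<close> with \<open>c \<in> C\<close>, in some order, reduce it to zero. This form
treats distinct and repeated roots alike.\<close>

inductive_set spectral_subspace :: "nat \<Rightarrow> complex mat \<Rightarrow> complex set \<Rightarrow> complex mat set"
  for n A C where
  zero: "0\<^sub>m n n \<in> spectral_subspace n A C"
| step: "X \<in> carrier_mat n n \<Longrightarrow> c \<in> C \<Longrightarrow> shifted_derivation A c X \<in> spectral_subspace n A C
    \<Longrightarrow> X \<in> spectral_subspace n A C"

lemma spectral_subspace_carrier:
  "X \<in> spectral_subspace n A C \<Longrightarrow> X \<in> carrier_mat n n"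
  by (induction rule: spectral_subspace.induct) auto

lemma spectral_subspace_shifted_derivation:
  assumes A: "A \<in> carrier_mat n n"
  shows "X \<in> spectral_subspace n A C \<Longrightarrow> shifted_derivation A d X \<in> spectral_subspace n A C"
proof (induction rule: spectral_subspace.induct)
  case zero
  then show ?case using A by (simp add: spectral_subspace.zero)
next
  case (step X c)
  then show ?case using A
    by (auto intro!: spectral_subspace.step[of "shifted_derivation A d X" n c]
        simp: shifted_derivation_commute[of A n X c d])
qed

lemma spectral_subspace_inner_derivation:
  assumes "A \<in> carrier_mat n n" "X \<in> spectral_subspace n A C"
  shows "inner_derivation A X \<in> spectral_subspace n A C"
proof -
  have X: "X \<in> carrier_mat n n" by (rule spectral_subspace_carrier[OF assms(2)])
  have "inner_derivation A X \<in> carrier_mat n n" using assms(1) X by simp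
  then have "shifted_derivation A 0 X = inner_derivation A X"
    using X unfolding shifted_derivation_def by (auto intro!: eq_matI)
  then show ?thesis using spectral_subspace_shifted_derivation[OF assms, of 0] by simp
qed

text \<open>The operators that kill \<open>X\<close> are applied to the sum one by one; what remains of \<open>Y\<close> changes along the
way, so \<open>Y\<close> has to be arbitrary in the induction.\<close>

lemma spectral_subspace_add:
  assumes A: "A \<in> carrier_mat n n"
  shows "X \<in> spectral_subspace n A C \<Longrightarrow> Y \<in> spectral_subspace n A C
    \<Longrightarrow> X + Y \<in> spectral_subspace n A C"
proof (induction arbitrary: Y rule: spectral_subspace.induct)
  case zero
  then show ?case using spectral_subspace_carrier[OF zero] by simp
next
  case (step X c)
  have Y: "Y \<in> carrier_mat n n" by (rule spectral_subspace_carrier[OF step.prems])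
  have "shifted_derivation A c (X + Y) \<in> spectral_subspace n A C"
    unfolding shifted_derivation_add[OF A step.hyps(1) Y]
    by (intro step.IH spectral_subspace_shifted_derivation[OF A] step.prems)
  then show ?case using step.hyps Y by (auto intro: spectral_subspace.step[of "X + Y" n c])
qed

text \<open>Applying \<open>\<Delta>\<^sub>A - (c + d)\<close> to \<open>X Y\<close> gives two products, in each of which one factor is closer to
zero. Hence the nested induction: the outer one handles the first product for every \<open>Y\<close>, the inner
one the second product for fixed \<open>X\<close>.\<close>

lemma spectral_subspace_mult:
  assumes A: "A \<in> carrier_mat n n"
    and E: "\<And>c d. c \<in> C \<Longrightarrow> d \<in> D \<Longrightarrow> c + d \<in> E"
    and X: "X \<in> spectral_subspace n A C" and Y: "Y \<in> spectral_subspace n A D"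
  shows "X * Y \<in> spectral_subspace n A E"
  using X Y
proof (induction arbitrary: Y rule: spectral_subspace.induct)
  case zero
  then show ?case
    using spectral_subspace_carrier[OF zero] by (simp add: spectral_subspace.zero)
next
  case (step X c)
  note outer = step.hyps and outer_IH = step.IH
  from step.prems show ?case
  proof (induction rule: spectral_subspace.induct)
    case zero
    then show ?case using outer(1) by (simp add: spectral_subspace.zero)
  next
    case (step Y d)
    have "Y \<in> spectral_subspace n A D" using step.hyps by (rule spectral_subspace.step)
    then have "shifted_derivation A c X * Y \<in> spectral_subspace n A E" by (rule outer_IH)
    then have "shifted_derivation A (c + d) (X * Y) \<in> spectral_subspace n A E"
      unfolding shifted_derivation_mult[OF A outer(1) step.hyps(1)]
      by (intro spectral_subspace_add[OF A] step.IH)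
    moreover have "X * Y \<in> carrier_mat n n" using outer(1) step(1) by simp
    ultimately show ?case using E[OF outer(2) step.hyps(2)]
      by (intro spectral_subspace.step[of "X * Y" n "c + d"])
  qed
qed

text \<open>Commutators have trace zero, so \<open>\<Delta>\<^sub>A - c\<close> multiplies the trace by \<open>- c\<close>; a matrix that non-zero
shifts reduce to zero therefore has trace zero.\<close>

lemma mat_trace_spectral_subspace:
  assumes A: "A \<in> carrier_mat n n" and C: "0 \<notin> C"
  shows "X \<in> spectral_subspace n A C \<Longrightarrow> mat_trace X = 0"
proof (induction rule: spectral_subspace.induct)
  case zero
  then show ?case by (simp add: mat_trace_def)
next
  case (step X c)
  have "inner_derivation A X \<in> carrier_mat n n" using A step.hyps by simp
  then have "mat_trace (shifted_derivation A c X) = mat_trace (inner_derivation A X) - c * mat_trace X"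
    using step.hyps unfolding shifted_derivation_def mat_trace_def
    by (simp add: sum_subtractf sum_distrib_left)
  then have "c * mat_trace X = 0"
    using step.IH mat_trace_inner_derivation[OF A step.hyps(1)] by simp
  then show ?case using step.hyps C by auto
qed

lemma spectral_subspace_pow:
  assumes A: "A \<in> carrier_mat n n" and S: "S \<in> spectral_subspace n A {z1, z2}"
  shows "S ^\<^sub>m k \<in> spectral_subspace n A {of_nat i * z1 + of_nat j * z2 | i j. i + j = k}"
proof (induction k)
  case 0
  have "shifted_derivation A 0 (1\<^sub>m n) = 0\<^sub>m n n"
    using A by (auto intro!: eq_matI simp: shifted_derivation_def inner_derivation_def)
  then show ?case using spectral_subspace_carrier[OF S]
    by (auto intro!: spectral_subspace.step[of "1\<^sub>m n" n 0] simp: spectral_subspace.zero)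
next
  case (Suc k)
  have "c + d \<in> {of_nat i * z1 + of_nat j * z2 | i j. i + j = Suc k}"
    if c: "c \<in> {of_nat i * z1 + of_nat j * z2 | i j. i + j = k}" and d: "d \<in> {z1, z2}" for c d
  proof -
    obtain i j where ij: "c = of_nat i * z1 + of_nat j * z2" "i + j = k" using c by blast
    from d consider "d = z1" | "d = z2" by blast
    then show ?thesis
    proof cases
      case 1
      then have "c + d = of_nat (Suc i) * z1 + of_nat j * z2" "Suc i + j = Suc k"
        using ij by (simp_all add: algebra_simps)
      then show ?thesis by blast
    next
      case 2
      then have "c + d = of_nat i * z1 + of_nat (Suc j) * z2" "i + Suc j = Suc k"
        using ij by (simp_all add: algebra_simps)
      then show ?thesis by blast
    qed
  qed
  then show ?case using spectral_subspace_mult[OF A _ Suc.IH S] by simp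
qed

lemma spectral_subspace_nilpotent:
  assumes A: "A \<in> carrier_mat n n" and S: "S \<in> spectral_subspace n A {z1, z2}"
    and nr: "\<And>i j. 1 \<le> i + j \<Longrightarrow> i + j \<le> n \<Longrightarrow> of_nat i * z1 + of_nat j * z2 \<noteq> 0"
  shows "nilpotent_mat S"
proof (rule traces_zero_imp_nilpotent[OF spectral_subspace_carrier[OF S]])
  fix k :: nat assume "1 \<le> k" "k \<le> n"
  then have "0 \<notin> {of_nat i * z1 + of_nat j * z2 | i j. i + j = k}" using nr by fastforce
  then show "mat_trace (S ^\<^sub>m k) = 0"
    by (rule mat_trace_spectral_subspace[OF A _ spectral_subspace_pow[OF A S]])
qed

text \<open>Jacobson's lemma. If \<open>U = \<Delta>\<^sub>A(T)\<close> commutes with \<open>A\<close>, then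
\<open>U\<^sup>l\<^sup>+\<^sup>1 = U\<^sup>l \<Delta>\<^sub>A(T) = \<Delta>\<^sub>A(U\<^sup>l T)\<close> is a commutator.\<close>

lemma commuting_inner_derivation_nilpotent:
  assumes A: "A \<in> carrier_mat n n" and T: "T \<in> carrier_mat n n"
    and U: "inner_derivation A (inner_derivation A T) = 0\<^sub>m n n"
  shows "nilpotent_mat (inner_derivation A T)"
proof -
  define U where "U = inner_derivation A T"
  have Uc: "U \<in> carrier_mat n n" using A T by (simp add: U_def)
  have com: "inner_derivation A (U ^\<^sub>m k) = 0\<^sub>m n n" for k
  proof (induction k)
    case 0
    then show ?case using A Uc by (auto simp: inner_derivation_def)
  next
    case (Suc k)
    then show ?case using A Uc U
      by (simp add: inner_derivation_mult[of A n] flip: U_def)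
  qed
  have "mat_trace (U ^\<^sub>m k) = 0" if k1: "1 \<le> k" for k
  proof -
    obtain l where k: "k = Suc l" using k1 by (cases k) auto
    have "U ^\<^sub>m l * U \<in> carrier_mat n n"
      by (rule mult_carrier_mat[of _ n n]) (use Uc in auto)
    then have "inner_derivation A (U ^\<^sub>m l * T) = U ^\<^sub>m k"
      using A T Uc by (simp add: k inner_derivation_mult[of A n] com flip: U_def)
    moreover have "U ^\<^sub>m l * T \<in> carrier_mat n n"
      by (rule mult_carrier_mat[of _ n n]) (use Uc T in auto)
    ultimately show ?thesis using mat_trace_inner_derivation[OF A] by metis
  qed
  then show ?thesis using traces_zero_imp_nilpotent[OF Uc] by (simp add: U_def)
qed

section \<open>The quadratic relation\<close>

lemma roots_of_quadratic_coeffs: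
  assumes "roots_of_quadratic \<alpha> \<beta> z1 z2"
  shows "complex_of_real \<alpha> = - (z1 + z2)" "complex_of_real \<beta> = z1 * z2"
  using assms by (simp_all add: roots_of_quadratic_def algebra_simps)

lemma quadratic_relation_iff:
  assumes r: "roots_of_quadratic \<alpha> \<beta> z1 z2"
  shows "quadratic_relation n \<alpha> \<beta> A T \<longleftrightarrow> A \<in> carrier_mat n n \<and> T \<in> carrier_mat n n \<and>
    shifted_derivation A z1 (shifted_derivation A z2 T) = 0\<^sub>m n n"
  unfolding quadratic_relation_def roots_of_quadratic_coeffs[OF r]
  by (auto simp: shifted_derivation_shifted_derivation[of A n T] numeral_2_eq_2)

lemma quadratic_relation_spectral_subspace:
  assumes r: "roots_of_quadratic \<alpha> \<beta> z1 z2" and q: "quadratic_relation n \<alpha> \<beta> A T"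
  shows "T \<in> spectral_subspace n A {z1, z2}"
proof -
  have c: "A \<in> carrier_mat n n" "T \<in> carrier_mat n n"
    "shifted_derivation A z1 (shifted_derivation A z2 T) = 0\<^sub>m n n"
    using q unfolding quadratic_relation_iff[OF r] by auto
  show ?thesis
    by (rule spectral_subspace.step[of _ _ z2], use c in simp, simp,
        rule spectral_subspace.step[of _ _ z1], use c in simp, simp,
        simp add: c spectral_subspace.zero)
qed

lemma quadratic_relation_nilpotent:
  assumes r: "roots_of_quadratic \<alpha> \<beta> z1 z2" and q: "quadratic_relation n \<alpha> \<beta> A T"
    and nr: "\<And>i j. 1 \<le> i + j \<Longrightarrow> i + j \<le> n \<Longrightarrow> of_nat i * z1 + of_nat j * z2 \<noteq> 0"
  shows "nilpotent_mat T \<and> nilpotent_mat (inner_derivation A T)"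
proof -
  have A: "A \<in> carrier_mat n n" using q by (simp add: quadratic_relation_def)
  note T = quadratic_relation_spectral_subspace[OF r q]
  show ?thesis
    using spectral_subspace_nilpotent[OF A T nr]
      spectral_subspace_nilpotent[OF A spectral_subspace_inner_derivation[OF A T] nr] by blast
qed

text \<open>Here \<open>z\<^sub>1 + z\<^sub>2\<close> is the root other than zero, or zero if both vanish, and the relation reads
\<open>(\<Delta>\<^sub>A - (z\<^sub>1 + z\<^sub>2))(\<Delta>\<^sub>A(T)) = 0\<close>.\<close>

lemma quadratic_relation_zero_root_nilpotent:
  assumes r: "roots_of_quadratic \<alpha> \<beta> z1 z2" and q: "quadratic_relation n \<alpha> \<beta> A T"
    and z: "z1 * z2 = 0"
  shows "nilpotent_mat (inner_derivation A T)"
proof -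
  have A: "A \<in> carrier_mat n n" and T: "T \<in> carrier_mat n n"
    and e: "shifted_derivation A z1 (shifted_derivation A z2 T) = 0\<^sub>m n n"
    using q unfolding quadratic_relation_iff[OF r] by auto
  define U where "U = inner_derivation A T"
  have U: "U \<in> carrier_mat n n" using A T by (simp add: U_def)
  have D: "inner_derivation A U \<in> carrier_mat n n" using A U by simp
  have "(z1 * z2) \<cdot>\<^sub>m T = 0\<^sub>m n n" using T z by (auto intro!: eq_matI)
  then have e': "shifted_derivation A (z1 + z2) U = 0\<^sub>m n n"
    using e U D unfolding shifted_derivation_shifted_derivation[OF A T] U_def[symmetric]
    by (simp add: shifted_derivation_def)
  show ?thesis
  proof (cases "z1 + z2 = 0")
    case True
    have "0 \<cdot>\<^sub>m U = 0\<^sub>m n n" using U by (auto intro!: eq_matI)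
    then have "inner_derivation A U = 0\<^sub>m n n"
      using e' U D unfolding shifted_derivation_def True by simp
    then show ?thesis using commuting_inner_derivation_nilpotent[OF A T] by (simp add: U_def)
  next
    case False
    have "U \<in> spectral_subspace n A {z1 + z2, z1 + z2}"
      by (rule spectral_subspace.step[of _ _ "z1 + z2"])
        (use U e' in \<open>simp_all add: spectral_subspace.zero\<close>)
    then have "nilpotent_mat U"
    proof (rule spectral_subspace_nilpotent[OF A])
      fix i j :: nat assume "1 \<le> i + j"
      then have "of_nat (i + j) \<noteq> (0 :: complex)" by (subst of_nat_eq_0_iff) linarith
      then have "of_nat (i + j) * (z1 + z2) \<noteq> 0" using False by (rule no_zero_divisors)
      then show "of_nat i * (z1 + z2) + of_nat j * (z1 + z2) \<noteq> 0"
        unfolding of_nat_add distrib_right .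
    qed
    then show ?thesis by (simp add: U_def)
  qed
qed

section \<open>Weighted cycles\<close>

definition weighted_cycle :: "nat \<Rightarrow> nat \<Rightarrow> (nat \<Rightarrow> complex) \<Rightarrow> complex mat" where
  "weighted_cycle n m w = mat n n (\<lambda>(i,j). if j < m \<and> i = Suc j mod m then w j else 0)"

lemma weighted_cycle_carrier [simp]: "weighted_cycle n m w \<in> carrier_mat n n"
  by (simp add: weighted_cycle_def)

lemma weighted_cycle_index:
  "i < n \<Longrightarrow> j < n \<Longrightarrow>
    weighted_cycle n m w $$ (i,j) = (if j < m \<and> i = Suc j mod m then w j else 0)"
  by (simp add: weighted_cycle_def)

text \<open>The \<open>k\<close>-th power moves the basis vector \<open>j\<close> to a non-zero multiple of the basis vector
\<open>(j + k) mod m\<close>.\<close>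

lemma weighted_cycle_not_nilpotent:
  assumes m: "0 < m" "m \<le> n" and w: "\<And>j. j < m \<Longrightarrow> w j \<noteq> 0"
  shows "\<not> nilpotent_mat (weighted_cycle n m w)"
proof -
  let ?M = "weighted_cycle n m w"
  have nz: "j < m \<Longrightarrow> (?M ^\<^sub>m k) $$ ((j + k) mod m, j) \<noteq> 0" for j k
  proof (induction k arbitrary: j)
    case 0
    then show ?case using m by (simp add: weighted_cycle_def)
  next
    case (Suc k)
    define r where "r = (j + Suc k) mod m"
    define j' where "j' = Suc j mod m"
    have b: "j < n" "r < n" "j' < n" "j' < m"
      using Suc.prems m by (auto simp: r_def j'_def intro: less_le_trans[OF mod_less_divisor])
    have "(?M ^\<^sub>m Suc k) $$ (r, j) = (\<Sum>l<n. (?M ^\<^sub>m k) $$ (r,l) * ?M $$ (l,j))"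
      by (rule pow_mat_Suc_index[OF weighted_cycle_carrier b(2,1)])
    also have "\<dots> = (\<Sum>l<n. if l = j' then (?M ^\<^sub>m k) $$ (r,l) * w j else 0)"
      using Suc.prems b(1) by (intro sum.cong) (auto simp: weighted_cycle_index j'_def)
    also have "\<dots> = (?M ^\<^sub>m k) $$ (r, j') * w j"
      using b(3) by simp
    also have "r = (j' + k) mod m"
      by (simp add: r_def j'_def mod_add_left_eq)
    finally have "(?M ^\<^sub>m Suc k) $$ ((j' + k) mod m, j) \<noteq> 0"
      using Suc.IH[OF b(4)] w[OF Suc.prems] by (simp only: mult_eq_0_iff) simp
    then show ?case using \<open>r = (j' + k) mod m\<close> by (simp only: r_def not_False_eq_True)
  qed
  show ?thesis
  proof
    assume "nilpotent_mat ?M"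
    then obtain k where k: "?M ^\<^sub>m k = 0\<^sub>m n n"
      unfolding nilpotent_mat_def by (auto simp: weighted_cycle_def)
    have "k mod m < n" using m by (auto intro: less_le_trans[OF mod_less_divisor])
    then show False using nz[of 0 k] m by (simp add: k)
  qed
qed

lemma inner_derivation_mat_diag_weighted_cycle:
  assumes "m \<le> n" "\<And>j. j < m \<Longrightarrow> a (Suc j mod m) - a j = s j"
  shows "inner_derivation (mat_diag n a) (weighted_cycle n m w) = weighted_cycle n m (\<lambda>j. s j * w j)"
proof -
  have "inner_derivation (mat_diag n a) (weighted_cycle n m w) =
      mat n n (\<lambda>(i,j). (a i - a j) * weighted_cycle n m w $$ (i,j))"
    unfolding inner_derivation_def mat_diag_mult_left[OF weighted_cycle_carrier]
      mat_diag_mult_right[OF weighted_cycle_carrier]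
    by (auto intro!: eq_matI simp: algebra_simps)
  also have "\<dots> = weighted_cycle n m (\<lambda>j. s j * w j)"
    using assms by (auto intro!: eq_matI simp: weighted_cycle_def)
  finally show ?thesis .
qed

text \<open>The walk \<open>a\<close> starts at \<open>0\<close>, makes \<open>q\<close> steps \<open>z\<^sub>1\<close> and then \<open>p\<close> steps \<open>z\<^sub>2\<close>; by the resonance it
closes up. Then \<open>\<Delta>\<^sub>A\<close> multiplies each entry of the cycle by its step, which is a
root.\<close>

lemma resonant_roots_not_nilpotent:
  assumes r: "roots_of_quadratic \<alpha> \<beta> z1 z2"
    and nz: "z1 \<noteq> 0" "z2 \<noteq> 0"
    and pq: "0 < p" "p + q \<le> n"
    and res: "of_nat q * z1 + of_nat p * z2 = 0"
  shows "\<exists>A T. quadratic_relation n \<alpha> \<beta> A T \<and>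
    \<not> nilpotent_mat T \<and> \<not> nilpotent_mat (inner_derivation A T)"
proof -
  define m where "m = p + q"
  define s where "s = (\<lambda>j. if j < q then z1 else z2)"
  define a where "a = (\<lambda>i. \<Sum>l<i. s l)"
  define A where "A = mat_diag n a"
  define T where "T = weighted_cycle n m (\<lambda>_. 1)"
  have m: "0 < m" "m \<le> n" using pq by (auto simp: m_def)
  have "a m = (\<Sum>l<q. s l) + (\<Sum>l\<in>{q..<m}. s l)"
    using sum.atLeastLessThan_concat[of 0 q m s] by (simp add: a_def m_def atLeast0LessThan)
  also have "\<dots> = of_nat q * z1 + of_nat p * z2" by (simp add: s_def m_def)
  finally have am: "a m = 0" using res by simp
  have step: "a (Suc j mod m) - a j = s j" if j: "j < m" for j
  proof (cases "Suc j = m")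
    case True
    then have "a (Suc j mod m) = a (Suc j)" using am by (simp add: a_def)
    then show ?thesis by (simp add: a_def)
  next
    case False
    then have "Suc j mod m = Suc j" using j by simp
    then show ?thesis by (simp add: a_def)
  qed
  have D: "inner_derivation A (weighted_cycle n m w) = weighted_cycle n m (\<lambda>j. s j * w j)" for w
    unfolding A_def using m(2) step by (rule inner_derivation_mat_diag_weighted_cycle)
  have S: "shifted_derivation A c (weighted_cycle n m w) = weighted_cycle n m (\<lambda>j. (s j - c) * w j)"
    for c w
    unfolding shifted_derivation_def D
    by (auto intro!: eq_matI simp: weighted_cycle_def algebra_simps)
  have "shifted_derivation A z1 (shifted_derivation A z2 T) = 0\<^sub>m n n"
    unfolding T_def S by (auto intro!: eq_matI simp: weighted_cycle_def s_def)
  moreover have "A \<in> carrier_mat n n" "T \<in> carrier_mat n n" by (simp_all add: A_def T_def)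
  ultimately have "quadratic_relation n \<alpha> \<beta> A T" unfolding quadratic_relation_iff[OF r] by blast
  moreover have "\<not> nilpotent_mat T" unfolding T_def
    by (rule weighted_cycle_not_nilpotent[OF m]) simp
  moreover have "\<not> nilpotent_mat (inner_derivation A T)" unfolding T_def D
    by (rule weighted_cycle_not_nilpotent[OF m]) (simp add: s_def nz)
  ultimately show ?thesis by blast
qed

section \<open>The five cases\<close>

text \<open>For \<open>\<beta> < 0\<close> the roots are real since their sum is real: if the imaginary parts were non-zero, the
roots would be conjugate and their product \<open>\<beta>\<close> would be a squared absolute value.\<close>

lemma real_roots_of_opposite_sign:
  assumes r: "roots_of_quadratic \<alpha> \<beta> z1 z2"
    and h: "(z1 \<in> \<real> \<and> z2 \<in> \<real> \<and> Re z1 * Re z2 < 0) \<or> \<beta> < 0"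
  obtains x y where "z1 = of_real x" "z2 = of_real y" "x * y < 0"
proof -
  have s: "Im z1 + Im z2 = 0" using arg_cong[OF roots_of_quadratic_coeffs(1)[OF r], of Im] by simp
  have p: "Re z1 * Re z2 - Im z1 * Im z2 = \<beta>" "Re z1 * Im z2 + Im z1 * Re z2 = 0"
    using arg_cong[OF roots_of_quadratic_coeffs(2)[OF r], of Re]
      arg_cong[OF roots_of_quadratic_coeffs(2)[OF r], of Im] by simp_all
  have im: "Im z2 = - Im z1" using s by simp
  have "Im z1 = 0 \<and> Re z1 * Re z2 < 0" if b: "\<beta> < 0"
  proof -
    have "Im z1 * (Re z2 - Re z1) = 0" using p(2) im by (simp add: algebra_simps)
    then have "Im z1 = 0 \<or> Re z2 = Re z1" by simp
    moreover have "Re z2 \<noteq> Re z1" if "Im z1 \<noteq> 0"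
    proof
      assume "Re z2 = Re z1"
      then have "\<beta> = Re z1 * Re z1 + Im z1 * Im z1" using p(1) im by simp
      then show False using b by (metis add_nonneg_nonneg not_le zero_le_square)
    qed
    ultimately have "Im z1 = 0" by blast
    then show ?thesis using p(1) b im by simp
  qed
  then have "Im z1 = 0 \<and> Im z2 = 0 \<and> Re z1 * Re z2 < 0"
    using h im by (auto simp: complex_is_Real_iff)
  then show thesis using that[of "Re z1" "Re z2"] by (auto simp: complex_eq_iff)
qed

lemma resonance_lowest_terms:
  fixes z1 z2 :: complex
  assumes nz: "z1 \<noteq> 0" "z2 \<noteq> 0"
    and ij: "1 \<le> i + j" and res: "of_nat i * z1 + of_nat j * z2 = 0"
  shows "\<exists>p q. neg_ratio_lowest_terms z1 z2 p q \<and> p + q \<le> i + j"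
proof -
  have "i \<noteq> 0"
  proof
    assume "i = 0"
    then have "of_nat j * z2 = 0" "j \<noteq> 0" using res ij by simp_all
    then show False using nz by simp
  qed
  moreover have "j \<noteq> 0"
  proof
    assume "j = 0"
    then have "of_nat i * z1 = 0" "i \<noteq> 0" using res ij by simp_all
    then show False using nz by simp
  qed
  ultimately have pos: "i > 0" "j > 0" by simp_all
  define p q where "p = j div gcd i j" and "q = i div gcd i j"
  have g: "p * gcd i j = j" "q * gcd i j = i" by (simp_all add: p_def q_def)
  have "p \<noteq> 0" "q \<noteq> 0" using g pos by (metis mult_0 less_irrefl)+
  then have pq: "p > 0" "q > 0" by simp_all
  have "coprime q p" unfolding p_def q_def using pos by (intro div_gcd_coprime) simp
  then have cop: "coprime p q" by (simp only: coprime_commute)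
  have "z1 / z2 = - (of_nat j / of_nat i)"
    using res nz pos by (simp add: field_simps add_eq_0_iff)
  also have "of_nat j / of_nat i = (of_nat (p * gcd i j) / of_nat (q * gcd i j) :: complex)"
    by (simp only: g)
  also have "\<dots> = of_nat p / of_nat q" using pos by simp
  finally have "z1 / z2 = - (of_nat p / of_nat q)" .
  then have "neg_ratio_lowest_terms z1 z2 p q"
    unfolding neg_ratio_lowest_terms_def using pq cop by blast
  moreover have "p + q \<le> i + j"
    unfolding p_def q_def using div_le_dividend[of j "gcd i j"] div_le_dividend[of i "gcd i j"]
    by linarith
  ultimately show ?thesis by blast
qed

lemma neg_ratio_lowest_terms_unique:
  assumes "neg_ratio_lowest_terms z1 z2 p q" "neg_ratio_lowest_terms z1 z2 p' q'"
  shows "p = p' \<and> q = q'"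
proof -
  have "(of_nat p / of_nat q :: complex) = of_nat p' / of_nat q'" "q > 0" "q' > 0"
    using assms by (auto simp: neg_ratio_lowest_terms_def)
  then have "(of_nat (p * q') :: complex) = of_nat (p' * q)" by (simp add: field_simps)
  then have e: "p * q' = p' * q" by (simp only: of_nat_eq_iff)
  have c: "coprime p q" "coprime p' q'" using assms by (auto simp: neg_ratio_lowest_terms_def)
  show ?thesis using coprime_crossproduct_nat[of p q p' q'] c e by (simp add: mult.commute coprime_commute)
qed

text \<open>A negative rational ratio \<open>a / b\<close> with \<open>b > 0\<close> is a resonance with the positive multiplicities \<open>b\<close>
and \<open>- a\<close>, which reduces to lowest terms.\<close>

lemma neg_ratio_lowest_terms_exists:
  assumes xy: "z1 = of_real x" "z2 = of_real y" "x * y < 0" and rat: "z1 / z2 \<in> \<rat>"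
  shows "\<exists>p q. neg_ratio_lowest_terms z1 z2 p q"
proof -
  obtain a b where ab: "b > 0" "z1 / z2 = of_int a / of_int b" using rat by (rule Rats_cases')
  have nz: "z1 \<noteq> 0" "z2 \<noteq> 0" using xy by auto
  have "of_real (x / y) = (of_real (of_int a / of_int b) :: complex)" using ab(2) xy by simp
  then have r: "x / y = of_int a / of_int b" by (simp only: of_real_eq_iff)
  have "x / y < 0" using xy(3) by (auto simp: divide_less_0_iff mult_less_0_iff)
  then have a: "a < 0" using r ab(1) by (auto simp: divide_less_0_iff)
  have "of_nat (nat b) * z1 + of_nat (nat (- a)) * z2 = 0"
    using ab nz a by (simp add: field_simps)
  moreover have "1 \<le> nat b + nat (- a)" using ab(1) by simp
  ultimately show ?thesis using resonance_lowest_terms[OF nz] by blast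
qed

lemma one_mat_not_nilpotent:
  assumes "n \<ge> 1" shows "\<not> nilpotent_mat (1\<^sub>m n)"
proof
  assume "nilpotent_mat (1\<^sub>m n)"
  then obtain k where "(1\<^sub>m n :: complex mat) ^\<^sub>m k = 0\<^sub>m n n" unfolding nilpotent_mat_def by auto
  moreover have "(1\<^sub>m n :: complex mat) ^\<^sub>m k = 1\<^sub>m n" by (induction k) auto
  ultimately have "(1\<^sub>m n :: complex mat) $$ (0,0) = 0\<^sub>m n n $$ (0,0)" by simp
  then show False using assms by simp
qed

lemma commuting_quadratic_relation:
  assumes "A \<in> carrier_mat n n" "T \<in> carrier_mat n n" "A * T = T * A"
  shows "quadratic_relation n \<alpha> 0 A T"
proof -
  have "inner_derivation A T = 0\<^sub>m n n" using assms by (auto simp: inner_derivation_def)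
  moreover have "inner_derivation A (0\<^sub>m n n) = 0\<^sub>m n n"
    using assms by (auto simp: inner_derivation_def)
  ultimately show ?thesis using assms
    by (auto intro!: eq_matI simp: quadratic_relation_def numeral_2_eq_2)
qed

lemma same_sign_nonresonant:
  fixes z1 z2 :: complex and i j :: nat
  assumes "Re z1 * Re z2 > 0" "1 \<le> i + j"
  shows "of_nat i * z1 + of_nat j * z2 \<noteq> 0"
proof
  assume "of_nat i * z1 + of_nat j * z2 = 0"
  then have "Re (of_nat i * z1 + of_nat j * z2) = 0" by simp
  then have e: "real i * Re z1 + real j * Re z2 = 0" by simp
  have ij: "real i > 0 \<or> real j > 0" "real i \<ge> 0" "real j \<ge> 0" using assms(2) by auto
  from assms(1) consider "Re z1 > 0" "Re z2 > 0" | "Re z1 < 0" "Re z2 < 0"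
    by (auto simp: zero_less_mult_iff)
  then show False
  proof cases
    case 1
    then have "real i * Re z1 + real j * Re z2 > 0"
      using ij by (auto intro: add_pos_nonneg add_nonneg_pos)
    then show False using e by simp
  next
    case 2
    then have "real i * (- Re z1) + real j * (- Re z2) > 0"
      using ij by (intro linorder_class.not_le_imp_less notI)
        (smt (verit, best) mult_pos_pos mult_nonneg_nonneg)
    then show False using e by simp
  qed
qed

(* Each case may be given either by its roots or by the coefficients. *)
theorem theorem8p1:
  fixes n :: nat and \<alpha> \<beta> :: real and z1 z2 :: complex
  assumes "n \<ge> 1"
    and "roots_of_quadratic \<alpha> \<beta> z1 z2"
  shows
    \<comment> \<open>double zero root\<close>
    "((z1 = 0 \<and> z2 = 0) \<or> (\<alpha> = 0 \<and> \<beta> = 0) \<longrightarrow>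
       (\<forall>A T. quadratic_relation n \<alpha> \<beta> A T \<longrightarrow> nilpotent_mat (inner_derivation A T)) \<and>
       (\<forall>A\<in>carrier_mat n n. \<forall>T\<in>carrier_mat n n.
          A * T = T * A \<and> \<not> nilpotent_mat T \<longrightarrow> quadratic_relation n \<alpha> \<beta> A T) \<and>
       (\<exists>A\<in>carrier_mat n n. \<exists>T\<in>carrier_mat n n.
          A * T = T * A \<and> \<not> nilpotent_mat T \<and> quadratic_relation n \<alpha> \<beta> A T)) \<and>
     \<comment> \<open>non-zero real parts of the same sign\<close>
     ((Re z1 \<noteq> 0 \<and> Re z2 \<noteq> 0 \<and> sgn (Re z1) = sgn (Re z2)) \<or>
      (z1 \<in> \<real> \<and> z2 \<in> \<real> \<and> z1 \<noteq> z2 \<and> Re (z1 * z2) > 0) \<or>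
      (z1 = z2 \<and> z1 \<noteq> 0) \<or>
      (\<exists>\<gamma> \<omega>. \<gamma> \<noteq> 0 \<and> \<omega> \<noteq> 0 \<and> z1 = Complex \<gamma> \<omega> \<and> z2 = Complex \<gamma> (- \<omega>)) \<longrightarrow>
       (\<forall>A T. quadratic_relation n \<alpha> \<beta> A T \<longrightarrow>
          nilpotent_mat T \<and> nilpotent_mat (inner_derivation A T))) \<and>
     \<comment> \<open>purely imaginary roots; for n = 1 the relation forces T = 0\<close>
     ((\<exists>\<omega>. \<omega> \<noteq> 0 \<and> z1 = Complex 0 \<omega> \<and> z2 = Complex 0 (- \<omega>)) \<and> n \<ge> 2 \<longrightarrow>
       (\<exists>A T. quadratic_relation n \<alpha> \<beta> A T \<and>
          \<not> nilpotent_mat T \<and> \<not> nilpotent_mat (inner_derivation A T))) \<and>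
     \<comment> \<open>one zero root and one non-zero real root\<close>
     ((z1 \<in> \<real> \<and> z2 \<in> \<real> \<and> (z1 = 0 \<and> z2 \<noteq> 0 \<or> z1 \<noteq> 0 \<and> z2 = 0)) \<or> (\<beta> = 0 \<and> \<alpha> \<noteq> 0) \<longrightarrow>
       (\<forall>A T. quadratic_relation n \<alpha> \<beta> A T \<longrightarrow> nilpotent_mat (inner_derivation A T)) \<and>
       (\<exists>A T. quadratic_relation n \<alpha> \<beta> A T \<and> \<not> nilpotent_mat T)) \<and>
     \<comment> \<open>real roots of opposite sign\<close>
     ((z1 \<in> \<real> \<and> z2 \<in> \<real> \<and> Re z1 * Re z2 < 0) \<or> \<beta> < 0 \<longrightarrow>
       (if z1 / z2 \<notin> \<rat> \<or> (\<exists>p q. neg_ratio_lowest_terms z1 z2 p q \<and> p + q > n)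
        then \<forall>A T. quadratic_relation n \<alpha> \<beta> A T \<longrightarrow>
               nilpotent_mat T \<and> nilpotent_mat (inner_derivation A T)
        else \<exists>A T. quadratic_relation n \<alpha> \<beta> A T \<and>
               \<not> nilpotent_mat T \<and> \<not> nilpotent_mat (inner_derivation A T)))"
proof (intro conjI impI)
  note coeffs = roots_of_quadratic_coeffs[OF assms(2)]
  have \<beta>0: "\<beta> = 0 \<longleftrightarrow> z1 * z2 = 0" by (metis coeffs(2) of_real_eq_0_iff)
  {
    assume "(z1 = 0 \<and> z2 = 0) \<or> (\<alpha> = 0 \<and> \<beta> = 0)"
    then have z: "z1 * z2 = 0" and b: "\<beta> = 0" using \<beta>0 by auto
    have "\<alpha> = 0"
      using \<open>(z1 = 0 \<and> z2 = 0) \<or> (\<alpha> = 0 \<and> \<beta> = 0)\<close> coeffs(1) by auto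
    show "\<forall>A T. quadratic_relation n \<alpha> \<beta> A T \<longrightarrow> nilpotent_mat (inner_derivation A T)"
      using quadratic_relation_zero_root_nilpotent[OF assms(2) _ z] by blast
    show "\<forall>A\<in>carrier_mat n n. \<forall>T\<in>carrier_mat n n.
        A * T = T * A \<and> \<not> nilpotent_mat T \<longrightarrow> quadratic_relation n \<alpha> \<beta> A T"
      using commuting_quadratic_relation b by blast
    show "\<exists>A\<in>carrier_mat n n. \<exists>T\<in>carrier_mat n n.
        A * T = T * A \<and> \<not> nilpotent_mat T \<and> quadratic_relation n \<alpha> \<beta> A T"
      using one_mat_not_nilpotent[OF assms(1)]
        commuting_quadratic_relation[of "1\<^sub>m n" n "1\<^sub>m n" \<alpha>] b
      by (intro bexI[of _ "1\<^sub>m n"]) auto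
  next
    assume h: "(Re z1 \<noteq> 0 \<and> Re z2 \<noteq> 0 \<and> sgn (Re z1) = sgn (Re z2)) \<or>
      (z1 \<in> \<real> \<and> z2 \<in> \<real> \<and> z1 \<noteq> z2 \<and> Re (z1 * z2) > 0) \<or>
      (z1 = z2 \<and> z1 \<noteq> 0) \<or>
      (\<exists>\<gamma> \<omega>. \<gamma> \<noteq> 0 \<and> \<omega> \<noteq> 0 \<and> z1 = Complex \<gamma> \<omega> \<and> z2 = Complex \<gamma> (- \<omega>))"
    have "Re z1 * Re z2 > 0"
    proof -
      \<comment> \<open>A repeated root is half of a real sum, hence real.\<close>
      have sq: "z1 = z2 \<Longrightarrow> Im z1 = 0" using arg_cong[OF coeffs(1), of Im] by simp
      have "Re z1 * Re z2 > 0" if "Re z1 \<noteq> 0" "Re z2 \<noteq> 0" "sgn (Re z1) = sgn (Re z2)"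
        using that by (auto simp: sgn_if zero_less_mult_iff split: if_splits)
      moreover have "Re z1 * Re z2 > 0" if "z1 \<in> \<real>" "z2 \<in> \<real>" "Re (z1 * z2) > 0"
        using that by (auto simp: complex_is_Real_iff)
      moreover have "Re z1 * Re z2 > 0" if "z1 = z2" "z1 \<noteq> 0"
        using that sq[OF that(1)] by (auto simp: zero_less_mult_iff complex_eq_iff)
      moreover have "Re z1 * Re z2 > 0" if "\<gamma> \<noteq> 0" "z1 = Complex \<gamma> \<omega>" "z2 = Complex \<gamma> (- \<omega>)" for \<gamma> \<omega>
        using that by (auto simp: zero_less_mult_iff)
      ultimately show ?thesis using h by blast
    qed
    then show "\<forall>A T. quadratic_relation n \<alpha> \<beta> A T \<longrightarrow>
        nilpotent_mat T \<and> nilpotent_mat (inner_derivation A T)"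
      using quadratic_relation_nilpotent[OF assms(2)] same_sign_nonresonant by blast
  next
    assume "(\<exists>\<omega>. \<omega> \<noteq> 0 \<and> z1 = Complex 0 \<omega> \<and> z2 = Complex 0 (- \<omega>)) \<and> n \<ge> 2"
    then show "\<exists>A T. quadratic_relation n \<alpha> \<beta> A T \<and>
        \<not> nilpotent_mat T \<and> \<not> nilpotent_mat (inner_derivation A T)"
      by (intro resonant_roots_not_nilpotent[OF assms(2), of 1 1]) (auto simp: complex_eq_iff)
  next
    assume "(z1 \<in> \<real> \<and> z2 \<in> \<real> \<and> (z1 = 0 \<and> z2 \<noteq> 0 \<or> z1 \<noteq> 0 \<and> z2 = 0)) \<or> (\<beta> = 0 \<and> \<alpha> \<noteq> 0)"
    then have z: "z1 * z2 = 0" and b: "\<beta> = 0" using \<beta>0 by auto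
    show "\<forall>A T. quadratic_relation n \<alpha> \<beta> A T \<longrightarrow> nilpotent_mat (inner_derivation A T)"
      using quadratic_relation_zero_root_nilpotent[OF assms(2) _ z] by blast
    show "\<exists>A T. quadratic_relation n \<alpha> \<beta> A T \<and> \<not> nilpotent_mat T"
      using one_mat_not_nilpotent[OF assms(1)]
        commuting_quadratic_relation[of "1\<^sub>m n" n "1\<^sub>m n" \<alpha>] b
      by auto
  next
    assume h: "(z1 \<in> \<real> \<and> z2 \<in> \<real> \<and> Re z1 * Re z2 < 0) \<or> \<beta> < 0"
    obtain x y where xy: "z1 = of_real x" "z2 = of_real y" "x * y < 0"
      using real_roots_of_opposite_sign[OF assms(2) h] by blast
    have nz: "z1 \<noteq> 0" "z2 \<noteq> 0" using xy(3) by (auto simp: xy(1,2))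
    show "if z1 / z2 \<notin> \<rat> \<or> (\<exists>p q. neg_ratio_lowest_terms z1 z2 p q \<and> p + q > n)
        then \<forall>A T. quadratic_relation n \<alpha> \<beta> A T \<longrightarrow>
               nilpotent_mat T \<and> nilpotent_mat (inner_derivation A T)
        else \<exists>A T. quadratic_relation n \<alpha> \<beta> A T \<and>
               \<not> nilpotent_mat T \<and> \<not> nilpotent_mat (inner_derivation A T)"
      (is "if ?C then ?N else ?E")
    proof (cases ?C)
      case True
      have "of_nat i * z1 + of_nat j * z2 \<noteq> 0" if "1 \<le> i + j" "i + j \<le> n" for i j :: nat
      proof
        assume "of_nat i * z1 + of_nat j * z2 = 0"
        then obtain p q where pq: "neg_ratio_lowest_terms z1 z2 p q" "p + q \<le> i + j"
          using resonance_lowest_terms[OF nz] \<open>1 \<le> i + j\<close> by blast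
        have "z1 / z2 \<in> \<rat>" using pq(1) by (simp add: neg_ratio_lowest_terms_def)
        then obtain p' q' where "neg_ratio_lowest_terms z1 z2 p' q'" "p' + q' > n" using True by blast
        then show False using neg_ratio_lowest_terms_unique[OF pq(1)] pq(2) that(2) by fastforce
      qed
      then have ?N using quadratic_relation_nilpotent[OF assms(2)] by blast
      then show ?thesis using True by (simp only: if_True)
    next
      case False
      then have "z1 / z2 \<in> \<rat>" by blast
      then obtain p q where pq: "neg_ratio_lowest_terms z1 z2 p q"
        using neg_ratio_lowest_terms_exists[OF xy] by blast
      then have "p + q \<le> n" using False by (meson not_le)
      moreover have "of_nat q * z1 + of_nat p * z2 = 0"
        using pq nz(2) by (auto simp: neg_ratio_lowest_terms_def field_simps)
      ultimately have ?E
        using pq nz by (intro resonant_roots_not_nilpotent[OF assms(2), of p q])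
          (auto simp: neg_ratio_lowest_terms_def)
      then show ?thesis using False by (simp only: if_False)
    qed
  }
qed

end
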